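(* Let $\Phi\subseteq V^*$ be an essential root system all of whose irreducible components are of classical type ($\mathrm A$, $\mathrm B$, $\mathrm C$ or $\mathrm D$), with root lattice $\mathcal L\subseteq V^*$. For every M-convex function $g:\mathcal L\to\mathbb R\cup\{+\infty\}$ of type $\Phi$, one has $\operatorname{conv} g=\overline{\operatorname{conv}} g$, and this function is the unique primal-integral locally polyhedral M-convex function $V^*\to\mathbb R\cup\{+\infty\}$ of type $\Phi$ whose restriction to $\mathcal L$ is $g$.
   Context: Root systems. $V$ is a finite-dimensional real inner product space with dual $V^*$, $\langle p,x\rangle=p(x)$ for $p\in V^*,x\in V$; $V^*$ carries the induced inner product. For $\alpha\in V^*\setminus\{0\}$, $\alpha^\vee\in V$ is $2/\|\alpha\|^2$ times the vector of $V$ representing $\alpha$, and $s_\alpha(p)=p-\langle p,\alpha^\vee\rangle\alpha$. A root system is a nonempty finite set $\Phi\subseteq V^*\setminus\{0\}$ with $s_\alpha(\beta)\in\Phi$, $\mathbb R\alpha\cap\Phi=\{\alpha,-\alpha\}$ and $\langle\alpha,\beta^\vee\rangle\in\mathbb Z$ for all $\alpha,\beta\in\Phi$. It is essential if $\operatorname{span}\Phi=V^*$; it decomposes uniquely into mutually orthogonal irreducible components. The root lattice $\mathcal L$ is the set of integer linear combinations of roots. Hulls. A function on $\mathcal L$ is regarded as a function on $V^*$ with value $+\infty$ off $\mathcal L$; $\operatorname{dom} g$ is the set where $g$ is finite. $(\operatorname{conv} g)(p)=\inf\sum_q\lambda(q)g(q)$ over finitely supported convex coefficients $\lambda$ on $\operatorname{dom}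 g$ with $\sum_q\lambda(q)q=p$; $(\overline{\operatorname{conv}} g)(p)=\sup\{\langle p,x\rangle-r: x\in V,r\in\mathbb R,\ \langle q,x\rangle-r\le g(q)\ \forall q\in\operatorname{dom} g\}$. Convexity notions. For a closed convex $P\subseteq V^*$ and $p\in P$, $\mathrm T_p(P)=\operatorname{cl}(\operatorname{cone}\{q-p:q\in P\})$ is the tangent cone. An M-convex cone of type $\Phi$ is a cone $\operatorname{cone}\Phi'$ with $\Phi'\subseteq\Phi$ ($\operatorname{cone}\emptyset=\{0\}$). An M-convex polyhedron of type $\Phi$ is a nonempty closed convex set $P\subseteq V^*$ such that $\mathrm T_p(P)$ is an M-convex cone for all $p\in P$ (such $P$ is a polyhedron); it is integral if $P=\operatorname{conv}(P\cap\mathcal L)$. A convex set is locally polyhedral if its intersection with every polytope is a polytope; a function is locally polyhedral convex if its epigraph is a locally polyhedral convex set. For a function $h$ on $V^*$, $\Pi(h)=\{\operatorname{argmin}(h-x): x\in V,\ \operatorname{argmin}(h-x)\neq\emptyset\}$, where $(h-x)(p)=h(p)-\langle p,x\rangle$. A primal-integral locally polyhedral M-convex function of type $\Phi$ is a proper locally polyhedral convex function $\hat g:V^*\to\mathbb R\cup\{+\infty\}$ such that every member of $\Pi(\hat g)$ is an integral M-convex polyhedron of type $\Phi$. A function $g:\mathcal L\to\mathbb R\cup\{+\infty\}$ is M-convex of type $\Phi$ if it is the restriction to $\mathcal L$ of some such $\hat g$. *)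

theory Defs
  imports "HOL-Analysis.Analysis"
begin

text \<open>
  A finite-dimensional real inner product space is a type of class \<open>euclidean_space\<close>.  The dual
  \<open>V\<^sup>*\<close> with its induced inner product is identified with \<open>V\<close> by the Riesz isometry, so the
  pairing of \<open>p \<in> V\<^sup>*\<close> with \<open>x \<in> V\<close> is \<open>p \<bullet> x\<close>.  Functions with values in the reals extended by
  \<open>+\<infinity>\<close> are \<open>ereal\<close>-valued functions that omit \<open>-\<infinity>\<close>.
\<close>

subsection \<open>Root systems\<close>

definition coroot :: "'a::euclidean_space \<Rightarrow> 'a" where
  "coroot \<alpha> = (2 / (norm \<alpha>)\<^sup>2) *\<^sub>R \<alpha>"

definition reflection :: "'a::euclidean_space \<Rightarrow> 'a \<Rightarrow> 'a" where
  "reflection \<alpha> p = p - (p \<bullet> coroot \<alpha>) *\<^sub>R \<alpha>"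

definition root_system :: "'a::euclidean_space set \<Rightarrow> bool" where
  "root_system \<Phi> \<longleftrightarrow>
     finite \<Phi> \<and> \<Phi> \<noteq> {} \<and> 0 \<notin> \<Phi> \<and>
     (\<forall>\<alpha>\<in>\<Phi>. \<forall>\<beta>\<in>\<Phi>. reflection \<alpha> \<beta> \<in> \<Phi>) \<and>
     (\<forall>\<alpha>\<in>\<Phi>. range (\<lambda>t::real. t *\<^sub>R \<alpha>) \<inter> \<Phi> = {\<alpha>, -\<alpha>}) \<and>
     (\<forall>\<alpha>\<in>\<Phi>. \<forall>\<beta>\<in>\<Phi>. \<alpha> \<bullet> coroot \<beta> \<in> \<int>)"

definition essential :: "'a::euclidean_space set \<Rightarrow> bool" where
  "essential \<Phi> \<longleftrightarrow> span \<Phi> = UNIV"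

definition irreducible_roots :: "'a::euclidean_space set \<Rightarrow> bool" where
  "irreducible_roots \<Phi> \<longleftrightarrow> \<Phi> \<noteq> {} \<and>
     \<not> (\<exists>\<Phi>1 \<Phi>2. \<Phi>1 \<noteq> {} \<and> \<Phi>2 \<noteq> {} \<and> \<Phi>1 \<union> \<Phi>2 = \<Phi> \<and> \<Phi>1 \<inter> \<Phi>2 = {} \<and>
         (\<forall>\<alpha>\<in>\<Phi>1. \<forall>\<beta>\<in>\<Phi>2. \<alpha> \<bullet> \<beta> = 0))"

definition irreducible_component :: "'a::euclidean_space set \<Rightarrow> 'a set \<Rightarrow> bool" where
  "irreducible_component \<Phi> \<Psi> \<longleftrightarrow>
     \<Psi> \<subseteq> \<Phi> \<and> irreducible_roots \<Psi> \<and> (\<forall>\<alpha>\<in>\<Psi>. \<forall>\<beta>\<in>\<Phi> - \<Psi>. \<alpha> \<bullet> \<beta> = 0)"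

text \<open>
  The standard classical root systems, with vectors of \<open>\<real>\<^sup>m\<close> written as functions \<open>nat \<Rightarrow> real\<close>
  vanishing outside \<open>{..<m}\<close>.  The system \<open>A_n\<close> lives in \<open>\<real>\<^sup>n\<^sup>+\<^sup>1\<close>, the others in \<open>\<real>\<^sup>n\<close>.
\<close>

definition unit_vec_fun :: "nat \<Rightarrow> nat \<Rightarrow> real" where
  "unit_vec_fun i = (\<lambda>k. if k = i then 1 else 0)"

definition dot_fun :: "nat \<Rightarrow> (nat \<Rightarrow> real) \<Rightarrow> (nat \<Rightarrow> real) \<Rightarrow> real" where
  "dot_fun m u v = (\<Sum>k<m. u k * v k)"

definition standard_A :: "nat \<Rightarrow> (nat \<Rightarrow> real) set" where
  "standard_A n =
     {(\<lambda>k. unit_vec_fun i k - unit_vec_fun j k) | i j. i < n + 1 \<and> j < n + 1 \<and> i \<noteq> j}"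

definition standard_D :: "nat \<Rightarrow> (nat \<Rightarrow> real) set" where
  "standard_D n =
     {(\<lambda>k. s * unit_vec_fun i k + t * unit_vec_fun j k) | i j s t.
        i < n \<and> j < n \<and> i \<noteq> j \<and> s \<in> {1, -1} \<and> t \<in> {1, -1}}"

definition standard_B :: "nat \<Rightarrow> (nat \<Rightarrow> real) set" where
  "standard_B n =
     standard_D n \<union> {(\<lambda>k. s * unit_vec_fun i k) | i s. i < n \<and> s \<in> {1, -1}}"

definition standard_C :: "nat \<Rightarrow> (nat \<Rightarrow> real) set" where
  "standard_C n =
     standard_D n \<union> {(\<lambda>k. 2 * s * unit_vec_fun i k) | i s. i < n \<and> s \<in> {1, -1}}"

text \<open>
  Isomorphism of root systems: a linear isomorphism between the spans that maps roots onto roots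
  and preserves the Cartan integers.  The map is given on the whole space, which is no restriction
  as linear maps extend from a subspace; only its values on \<open>span \<Psi>\<close> matter.
\<close>

definition isomorphic_to_standard ::
    "nat \<Rightarrow> 'a::euclidean_space set \<Rightarrow> (nat \<Rightarrow> real) set \<Rightarrow> bool" where
  "isomorphic_to_standard m \<Psi> M \<longleftrightarrow>
     (\<exists>f :: 'a \<Rightarrow> nat \<Rightarrow> real.
        (\<forall>k. linear (\<lambda>x. f x k)) \<and> inj_on f (span \<Psi>) \<and> f ` \<Psi> = M \<and>
        (\<forall>\<alpha>\<in>\<Psi>. \<forall>\<beta>\<in>\<Psi>.
           2 * dot_fun m (f \<alpha>) (f \<beta>) / dot_fun m (f \<beta>) (f \<beta>) = \<alpha> \<bullet> coroot \<beta>))"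

text \<open>The rank bounds are the usual ones that avoid the low-rank coincidences.\<close>

definition classical_type :: "'a::euclidean_space set \<Rightarrow> bool" where
  "classical_type \<Psi> \<longleftrightarrow>
     (\<exists>n\<ge>1. isomorphic_to_standard (n + 1) \<Psi> (standard_A n)) \<or>
     (\<exists>n\<ge>2. isomorphic_to_standard n \<Psi> (standard_B n)) \<or>
     (\<exists>n\<ge>3. isomorphic_to_standard n \<Psi> (standard_C n)) \<or>
     (\<exists>n\<ge>4. isomorphic_to_standard n \<Psi> (standard_D n))"

definition root_lattice :: "'a::euclidean_space set \<Rightarrow> 'a set" where
  "root_lattice \<Phi> = {(\<Sum>\<alpha>\<in>\<Phi>. of_int (c \<alpha>) *\<^sub>R \<alpha>) | c :: 'a \<Rightarrow> int. True}"

subsection \<open>Hulls of extended real functions\<close>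

definition restrict_fun :: "'a set \<Rightarrow> ('a \<Rightarrow> ereal) \<Rightarrow> 'a \<Rightarrow> ereal" where
  "restrict_fun L h = (\<lambda>p. if p \<in> L then h p else \<infinity>)"

definition eff_dom :: "('a \<Rightarrow> ereal) \<Rightarrow> 'a set" where
  "eff_dom g = {p. \<bar>g p\<bar> \<noteq> \<infinity>}"

definition conv_fun :: "('a::euclidean_space \<Rightarrow> ereal) \<Rightarrow> 'a \<Rightarrow> ereal" where
  "conv_fun g p =
     Inf {(\<Sum>q\<in>S. ereal (u q) * g q) | S u.
            finite S \<and> S \<subseteq> eff_dom g \<and> (\<forall>q\<in>S. 0 \<le> u q) \<and> sum u S = 1 \<and>
            (\<Sum>q\<in>S. u q *\<^sub>R q) = p}"

definition closed_conv_fun :: "('a::euclidean_space \<Rightarrow> ereal) \<Rightarrow> 'a \<Rightarrow> ereal" where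
  "closed_conv_fun g p =
     Sup {ereal (p \<bullet> x - r) | x r. \<forall>q\<in>eff_dom g. ereal (q \<bullet> x - r) \<le> g q}"

subsection \<open>M-convexity\<close>

definition tangent_cone :: "'a::euclidean_space set \<Rightarrow> 'a \<Rightarrow> 'a set" where
  "tangent_cone P p = closure (convex_cone hull {q - p | q. q \<in> P})"

definition M_convex_cone :: "'a::euclidean_space set \<Rightarrow> 'a set \<Rightarrow> bool" where
  "M_convex_cone \<Phi> K \<longleftrightarrow> (\<exists>\<Phi>'\<subseteq>\<Phi>. K = convex_cone hull \<Phi>')"

definition M_convex_polyhedron :: "'a::euclidean_space set \<Rightarrow> 'a set \<Rightarrow> bool" where
  "M_convex_polyhedron \<Phi> P \<longleftrightarrow>
     P \<noteq> {} \<and> closed P \<and> convex P \<and> (\<forall>p\<in>P. M_convex_cone \<Phi> (tangent_cone P p))"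

definition integral_M_convex_polyhedron :: "'a::euclidean_space set \<Rightarrow> 'a set \<Rightarrow> bool" where
  "integral_M_convex_polyhedron \<Phi> P \<longleftrightarrow>
     M_convex_polyhedron \<Phi> P \<and> P = convex hull (P \<inter> root_lattice \<Phi>)"

definition locally_polyhedral :: "'a::euclidean_space set \<Rightarrow> bool" where
  "locally_polyhedral S \<longleftrightarrow> convex S \<and> (\<forall>Q. polytope Q \<longrightarrow> polytope (S \<inter> Q))"

definition proper_fun :: "('a \<Rightarrow> ereal) \<Rightarrow> bool" where
  "proper_fun h \<longleftrightarrow> (\<forall>p. h p \<noteq> -\<infinity>) \<and> (\<exists>p. h p \<noteq> \<infinity>)"

definition ereal_epigraph :: "('a \<Rightarrow> ereal) \<Rightarrow> ('a \<times> real) set" where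
  "ereal_epigraph h = {(p, r). h p \<le> ereal r}"

definition locally_polyhedral_convex_fun :: "('a::euclidean_space \<Rightarrow> ereal) \<Rightarrow> bool" where
  "locally_polyhedral_convex_fun h \<longleftrightarrow> locally_polyhedral (ereal_epigraph h)"

definition argmin_set :: "('a \<Rightarrow> ereal) \<Rightarrow> 'a set" where
  "argmin_set h = {p. \<forall>q. h p \<le> h q}"

definition argmin_sets :: "('a::euclidean_space \<Rightarrow> ereal) \<Rightarrow> 'a set set" where
  "argmin_sets h =
     {argmin_set (\<lambda>p. h p - ereal (p \<bullet> x)) | x.
        argmin_set (\<lambda>p. h p - ereal (p \<bullet> x)) \<noteq> {}}"

definition primal_integral_M_convex_fun ::
    "'a::euclidean_space set \<Rightarrow> ('a \<Rightarrow> ereal) \<Rightarrow> bool" where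
  "primal_integral_M_convex_fun \<Phi> h \<longleftrightarrow>
     proper_fun h \<and> locally_polyhedral_convex_fun h \<and>
     (\<forall>P\<in>argmin_sets h. integral_M_convex_polyhedron \<Phi> P)"

text \<open>
  A function on the root lattice is represented by its extension by \<open>+\<infinity>\<close> to the whole space.
\<close>

definition M_convex_lattice_fun :: "'a::euclidean_space set \<Rightarrow> ('a \<Rightarrow> ereal) \<Rightarrow> bool" where
  "M_convex_lattice_fun \<Phi> g \<longleftrightarrow>
     (\<exists>h. primal_integral_M_convex_fun \<Phi> h \<and> g = restrict_fun (root_lattice \<Phi>) h)"

end

theory Submission
  imports Defs
begin

text \<open>
  Let \<open>h\<close> be any primal-integral locally polyhedral M-convex function whose restriction to the
  root lattice is \<open>g\<close>.  All assertions follow from the chain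
  \<open>h \<le> closed_conv_fun g \<le> conv_fun g \<le> h\<close>, since it applies both to an \<open>h\<close> that witnesses the
  M-convexity of \<open>g\<close> and to any competitor in the uniqueness claim.

  The middle inequality is Jensen's inequality for affine functions.

  For the outer ones, the key point is that local polyhedrality gives \<open>h\<close> a subgradient at
  \<^emph>\<open>every\<close> point \<open>p\<close> of its effective domain, boundary points included
  (\<open>subgradient_exists\<close>): near \<open>(p, h p)\<close> the epigraph is a polytope, so it generates a closed
  cone at that point, and a hyperplane that supports this cone at its apex and has the downward
  vertical direction strictly on the other side is, translated to \<open>(p, h p)\<close>, the graph of an
  affine minorant of \<open>h\<close> that is exact at \<open>p\<close>.  Hence
  \<open>h p \<le> closed_conv_fun g p\<close> on the effective domain.  Off the effective domain, the epigraph
  being closed, affine minorants take arbitrarily large values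
  (\<open>affine_minorant_unbounded_off_domain\<close>).  Finally, if \<open>x\<close> is a subgradient at \<open>p\<close>, then \<open>p\<close>
  lies in the set of minimisers of \<open>h - x\<close>.  By integrality \<open>p\<close> is a convex combination of
  lattice points in this set, and \<open>h\<close> agrees with an affine function there, so that combination
  shows \<open>conv_fun g p \<le> h p\<close>.
\<close>

section \<open>Locally polyhedral sets\<close>

lemma closed_if_locally_polyhedral:
  fixes S :: "'a::euclidean_space set"
  assumes "locally_polyhedral S"
  shows "closed S"
proof -
  have "l \<in> S" if x: "\<And>n::nat. x n \<in> S" and lim: "x \<longlonglongrightarrow> l" for x l
  proof -
    have "bounded (range x)"
      using lim convergent_imp_bounded by blast
    then obtain a where a: "range x \<subseteq> cbox (- a) a"
      by (rule bounded_subset_cbox_symmetric)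
    have "polytope (S \<inter> cbox (- a) a)"
      using assms by (simp add: locally_polyhedral_def polytope_interval)
    then have "closed (S \<inter> cbox (- a) a)"
      by (simp add: polytope_imp_closed)
    moreover have "x n \<in> S \<inter> cbox (- a) a" for n
      using a x by blast
    ultimately show ?thesis
      using lim closed_sequentially by blast
  qed
  then show ?thesis
    unfolding closed_sequential_limits by blast
qed

text \<open>
  Locally polyhedral sets generate closed cones at each of their points.  In general the cone
  generated by a closed convex set at a boundary point need not be closed.  The last two
  conclusions say that \<open>K\<close> is exactly the cone generated by \<open>E - z0\<close>.
\<close>

lemma locally_polyhedral_closed_cone:
  fixes E :: "'b::euclidean_space set"
  assumes "locally_polyhedral E" and "z0 \<in> E"
  obtains K where "closed K" "convex K" "conic K" "\<And>z. z \<in> E \<Longrightarrow> z - z0 \<in> K"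
    "\<And>d. d \<in> K \<Longrightarrow> d \<noteq> 0 \<Longrightarrow> \<exists>t>0. z0 + t *\<^sub>R d \<in> E"
proof -
  define B where "B = cbox (z0 - One) (z0 + One)"
  define Q where "Q = (+) (- z0) ` (E \<inter> B)"
  have "polytope (E \<inter> B)"
    using assms(1) by (simp add: locally_polyhedral_def B_def polytope_interval)
  then have Q: "polytope Q"
    unfolding Q_def by (simp only: polytope_translation_eq)
  show thesis
  proof (rule that)
    show "closed (conic hull Q)"
      using Q polyhedron_conic_hull_polytope polyhedron_imp_closed by blast
    show "convex (conic hull Q)"
      using Q by (simp add: convex_conic_hull polytope_imp_convex)
    show "conic (conic hull Q)"
      by (simp add: conic_conic_hull)
  next
    fix z assume z: "z \<in> E"
    define t where "t = 1 / (1 + norm (z - z0))"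
    have t: "t > 0" "t \<le> 1" "t * norm (z - z0) \<le> 1"
      by (auto simp: t_def divide_simps add_pos_nonneg)
    have "(1 - t) *\<^sub>R z0 + t *\<^sub>R z \<in> E"
      using assms z t by (intro convexD) (auto simp: locally_polyhedral_def)
    then have inE: "z0 + t *\<^sub>R (z - z0) \<in> E"
      by (simp add: algebra_simps)
    have "\<bar>t * ((z - z0) \<bullet> i)\<bar> \<le> 1" if "i \<in> Basis" for i
    proof -
      have "\<bar>t * ((z - z0) \<bullet> i)\<bar> \<le> t * norm (z - z0)"
        using t Basis_le_norm[OF that, of "z - z0"] by (simp add: abs_mult)
      then show ?thesis
        using t by linarith
    qed
    then have "z0 + t *\<^sub>R (z - z0) \<in> B"
      by (force simp: B_def mem_box inner_add_left inner_diff_left abs_le_iff)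
    then have "t *\<^sub>R (z - z0) \<in> Q"
      unfolding Q_def using inE by (intro image_eqI[of _ _ "z0 + t *\<^sub>R (z - z0)"]) auto
    then have "(1 / t) *\<^sub>R (t *\<^sub>R (z - z0)) \<in> conic hull Q"
      using t unfolding conic_hull_explicit by fastforce
    then show "z - z0 \<in> conic hull Q"
      using t by simp
  next
    fix d assume "d \<in> conic hull Q" "d \<noteq> 0"
    then obtain c q where d: "d = c *\<^sub>R q" "c \<ge> 0" "q \<in> Q"
      by (auto simp: conic_hull_explicit)
    with \<open>d \<noteq> 0\<close> have "c > 0"
      by (cases "c = 0") auto
    moreover have "z0 + q \<in> E"
      using d by (auto simp: Q_def)
    ultimately show "\<exists>t>0. z0 + t *\<^sub>R d \<in> E"
      using d by (intro exI[of _ "1 / c"]) auto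
  qed
qed

section \<open>Affine minorants of locally polyhedral convex functions\<close>

lemma subgradient_exists:
  fixes h :: "'a::euclidean_space \<Rightarrow> ereal"
  assumes lp: "locally_polyhedral_convex_fun h" and hp: "h p = ereal c"
  obtains x where "\<And>q. ereal (c + (q - p) \<bullet> x) \<le> h q"
proof -
  define E where "E = ereal_epigraph h"
  have E: "locally_polyhedral E" "(p, c) \<in> E"
    using lp hp by (auto simp: E_def locally_polyhedral_convex_fun_def ereal_epigraph_def)
  then obtain K where K: "closed K" "convex K" "conic K" "\<And>z. z \<in> E \<Longrightarrow> z - (p, c) \<in> K"
    "\<And>d. d \<in> K \<Longrightarrow> d \<noteq> 0 \<Longrightarrow> \<exists>t>0. (p, c) + t *\<^sub>R d \<in> E"
    using locally_polyhedral_closed_cone by metis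
  \<comment> \<open>the epigraph contains no point vertically below \<open>(p, c)\<close>\<close>
  have "(0, -1) \<notin> K"
  proof
    assume "(0, -1) \<in> K"
    then obtain t where "t > 0" "(p, c) + t *\<^sub>R (0, -1) \<in> E"
      using K(5)[of "(0, -1)"] by (auto simp: zero_prod_def)
    then show False
      using hp by (simp add: E_def ereal_epigraph_def)
  qed
  then obtain a b where ab: "a \<bullet> (0, -1) < b" "\<And>z. z \<in> K \<Longrightarrow> a \<bullet> z > b"
    using separating_hyperplane_closed_point[OF K(2,1)] by blast
  obtain u s where a: "a = (u, s)"
    by (cases a)
  have "0 \<in> K"
    using K(4)[OF E(2)] by (simp add: zero_prod_def)
  then have b: "b < 0"
    using ab(2)[of 0] by simp
  then have s: "s > 0"
    using ab(1) by (simp add: a)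
  \<comment> \<open>a linear form bounded below on a cone is nonnegative on it\<close>
  have nonneg: "a \<bullet> z \<ge> 0" if z: "z \<in> K" for z
  proof (rule ccontr)
    assume neg: "\<not> a \<bullet> z \<ge> 0"
    define t where "t = b / (a \<bullet> z)"
    have "t \<ge> 0"
      using neg b by (simp add: t_def divide_nonpos_neg)
    then have "t *\<^sub>R z \<in> K"
      using K(3) z unfolding conic_def by blast
    then have "a \<bullet> (t *\<^sub>R z) > b"
      by (rule ab(2))
    then show False
      using neg by (simp add: t_def)
  qed
  have "ereal (c + (q - p) \<bullet> (- (1 / s) *\<^sub>R u)) \<le> h q" for q
  proof (rule ereal_le_real)
    fix r assume "h q \<le> ereal r"
    then have "(q, r) - (p, c) \<in> K"
      by (intro K(4)) (simp add: E_def ereal_epigraph_def)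
    then have "u \<bullet> (q - p) + s * (r - c) \<ge> 0"
      using nonneg by (fastforce simp: a)
    then show "ereal (c + (q - p) \<bullet> (- (1 / s) *\<^sub>R u)) \<le> ereal r"
      using s by (simp add: inner_commute field_simps)
  qed
  then show thesis
    by (rule that)
qed

lemma affine_minorant_unbounded_off_domain:
  fixes h :: "'a::euclidean_space \<Rightarrow> ereal"
  assumes lp: "locally_polyhedral_convex_fun h" and proper: "proper_fun h" and hp: "h p = \<infinity>"
  obtains x r where "\<And>q. ereal (q \<bullet> x - r) \<le> h q" "p \<bullet> x - r \<ge> M"
proof -
  define E where "E = ereal_epigraph h"
  have lpE: "locally_polyhedral E"
    using lp by (simp add: E_def locally_polyhedral_convex_fun_def)
  obtain p1 c where p1: "h p1 = ereal c"
    using proper unfolding proper_fun_def by (metis ereal_cases)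
  have "(p, M) \<notin> E"
    using hp by (simp add: E_def ereal_epigraph_def)
  then obtain a b where ab: "a \<bullet> (p, M) < b" "\<And>z. z \<in> E \<Longrightarrow> a \<bullet> z > b"
    using separating_hyperplane_closed_point[of E "(p, M)"] lpE closed_if_locally_polyhedral
    unfolding locally_polyhedral_def by blast
  obtain u s where a: "a = (u, s)"
    by (cases a)
  have sep: "u \<bullet> q + s * r > b" if "h q \<le> ereal r" for q r
    using ab(2)[of "(q, r)"] that by (simp add: a E_def ereal_epigraph_def)
  have sepp: "u \<bullet> p + s * M < b"
    using ab(1) by (simp add: a)
  \<comment> \<open>the epigraph extends upwards indefinitely above \<open>p1\<close>\<close>
  have "s \<ge> 0"
  proof (rule ccontr)
    assume s: "\<not> s \<ge> 0"
    define r where "r = max c ((b - u \<bullet> p1) / s)"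
    have "u \<bullet> p1 + s * r > b"
      using p1 by (intro sep) (simp add: r_def)
    moreover have "s * r \<le> s * ((b - u \<bullet> p1) / s)"
      using s by (intro mult_left_mono_neg) (auto simp: r_def)
    ultimately show False
      using s by simp
  qed
  then consider "s > 0" | "s = 0"
    by linarith
  then show thesis
  proof cases
    case 1
    show thesis
    proof (rule that)
      fix q
      show "ereal (q \<bullet> (- (1 / s) *\<^sub>R u) - (- b / s)) \<le> h q"
      proof (rule ereal_le_real)
        fix r assume "h q \<le> ereal r"
        then have "u \<bullet> q + s * r > b"
          by (rule sep)
        then show "ereal (q \<bullet> (- (1 / s) *\<^sub>R u) - (- b / s)) \<le> ereal r"
          using 1 by (simp add: inner_commute field_simps)
      qed
    next
      show "M \<le> p \<bullet> (- (1 / s) *\<^sub>R u) - (- b / s)"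
        using sepp 1 by (simp add: inner_commute field_simps)
    qed
  next
    \<comment> \<open>A vertical hyperplane separates \<open>p\<close> from the effective domain.  Tilting a fixed minorant
        by a large multiple \<open>k\<close> of it raises the value at \<open>p\<close> and lowers those on the domain.\<close>
    case 2
    obtain x where x: "\<And>q. ereal (c + (q - p1) \<bullet> x) \<le> h q"
      using subgradient_exists[OF lp p1] by blast
    define v where "v = c + (p - p1) \<bullet> x"
    define k where "k = \<bar>M - v\<bar> / (b - u \<bullet> p)"
    have pos: "b - u \<bullet> p > 0"
      using sepp 2 by simp
    then have k: "k \<ge> 0" "k * (b - u \<bullet> p) = \<bar>M - v\<bar>"
      by (auto simp: k_def)
    show thesis
    proof (rule that)
      fix q
      show "ereal (q \<bullet> (x - k *\<^sub>R u) - (p1 \<bullet> x - c - k * b)) \<le> h q"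
      proof (rule ereal_le_real)
        fix r assume hq: "h q \<le> ereal r"
        then have "u \<bullet> q > b"
          using sep[OF hq] 2 by simp
        then have "k * (b - u \<bullet> q) \<le> 0"
          using k by (simp add: mult_nonneg_nonpos)
        moreover have "c + (q - p1) \<bullet> x \<le> r"
          using order_trans[OF x hq] by simp
        ultimately show "ereal (q \<bullet> (x - k *\<^sub>R u) - (p1 \<bullet> x - c - k * b)) \<le> ereal r"
          by (simp add: inner_commute algebra_simps)
      qed
    next
      have "p \<bullet> (x - k *\<^sub>R u) - (p1 \<bullet> x - c - k * b) = v + k * (b - u \<bullet> p)"
        by (simp add: v_def inner_commute algebra_simps)
      then show "M \<le> p \<bullet> (x - k *\<^sub>R u) - (p1 \<bullet> x - c - k * b)"
        using k by linarith
    qed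
  qed
qed

section \<open>Comparison with the convex hull and the closed convex hull\<close>

lemma closed_conv_fun_le_conv_fun:
  fixes g :: "'a::euclidean_space \<Rightarrow> ereal"
  shows "closed_conv_fun g p \<le> conv_fun g p"
  unfolding closed_conv_fun_def conv_fun_def
proof (intro Sup_least Inf_greatest, clarsimp)
  fix x :: 'a and r :: real and S :: "'a set" and u :: "'a \<Rightarrow> real"
  assume minor: "\<forall>q\<in>eff_dom g. ereal (q \<bullet> x - r) \<le> g q"
    and S: "S \<subseteq> eff_dom g" and u: "\<forall>q\<in>S. 0 \<le> u q" "sum u S = 1"
  have "(\<Sum>q\<in>S. u q *\<^sub>R q) \<bullet> x - r = (\<Sum>q\<in>S. u q * (q \<bullet> x - r))"
    using u by (simp add: inner_sum_left right_diff_distrib sum_subtractf flip: sum_distrib_right)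
  also have "ereal \<dots> = (\<Sum>q\<in>S. ereal (u q) * ereal (q \<bullet> x - r))"
    by simp
  also have "\<dots> \<le> (\<Sum>q\<in>S. ereal (u q) * g q)"
    using minor S u by (intro sum_mono ereal_mult_left_mono) auto
  finally show "ereal ((\<Sum>q\<in>S. u q *\<^sub>R q) \<bullet> x - r) \<le> (\<Sum>q\<in>S. ereal (u q) * g q)" .
qed

lemma le_closed_conv_fun_restrict:
  fixes h :: "'a::euclidean_space \<Rightarrow> ereal"
  assumes lp: "locally_polyhedral_convex_fun h" and proper: "proper_fun h"
  shows "h p \<le> closed_conv_fun (restrict_fun L h) p"
proof -
  have minor: "ereal (p \<bullet> x - r) \<le> closed_conv_fun (restrict_fun L h) p"
    if "\<And>q. ereal (q \<bullet> x - r) \<le> h q" for x r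
    unfolding closed_conv_fun_def
    by (rule Sup_upper) (use that in \<open>auto simp: restrict_fun_def\<close>)
  show ?thesis
  proof (cases "h p")
    case (real c)
    then obtain x where x: "\<And>q. ereal (c + (q - p) \<bullet> x) \<le> h q"
      using subgradient_exists[OF lp real] by blast
    have "ereal (p \<bullet> x - (p \<bullet> x - c)) \<le> closed_conv_fun (restrict_fun L h) p"
      using x by (intro minor) (simp add: algebra_simps)
    then show ?thesis
      by (simp add: real)
  next
    case PInf
    have "ereal M \<le> closed_conv_fun (restrict_fun L h) p" for M
    proof -
      obtain x r where xr: "\<And>q. ereal (q \<bullet> x - r) \<le> h q" "p \<bullet> x - r \<ge> M"
        using affine_minorant_unbounded_off_domain[OF lp proper PInf] by blast
      then have "ereal M \<le> ereal (p \<bullet> x - r)"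
        by simp
      also have "\<dots> \<le> closed_conv_fun (restrict_fun L h) p"
        using xr by (intro minor)
      finally show ?thesis .
    qed
    then show ?thesis
      by (metis ereal_top order_refl PInf)
  next
    case MInf
    then show ?thesis
      by simp
  qed
qed

lemma conv_fun_restrict_le:
  fixes h :: "'a::euclidean_space \<Rightarrow> ereal"
  assumes lp: "locally_polyhedral_convex_fun h" and proper: "proper_fun h"
    and hulls: "\<And>P. P \<in> argmin_sets h \<Longrightarrow> P = convex hull (P \<inter> L)"
  shows "conv_fun (restrict_fun L h) p \<le> h p"
proof (cases "h p")
  case (real c)
  then obtain x where x: "\<And>q. ereal (c + (q - p) \<bullet> x) \<le> h q"
    using subgradient_exists[OF lp real] by blast
  define P where "P = argmin_set (\<lambda>q. h q - ereal (q \<bullet> x))"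
  have "h p - ereal (p \<bullet> x) \<le> h q - ereal (q \<bullet> x)" for q
    using x[of q] by (cases "h q") (auto simp: real algebra_simps)
  then have pP: "p \<in> P"
    by (simp add: P_def argmin_set_def)
  then have "P \<in> argmin_sets h"
    unfolding argmin_sets_def P_def by blast
  then have "p \<in> convex hull (P \<inter> L)"
    using hulls pP by blast
  then obtain S u where S: "finite S" "S \<subseteq> P \<inter> L" and u: "\<forall>q\<in>S. 0 \<le> u q" "sum u S = 1"
    and comb: "(\<Sum>q\<in>S. u q *\<^sub>R q) = p"
    unfolding convex_hull_explicit by blast
  have on_P: "h q = ereal (c + (q - p) \<bullet> x)" if "q \<in> P" for q
  proof (rule antisym)
    have "h q - ereal (q \<bullet> x) \<le> h p - ereal (p \<bullet> x)"
      using that by (simp add: P_def argmin_set_def)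
    then show "h q \<le> ereal (c + (q - p) \<bullet> x)"
      by (cases "h q") (auto simp: real algebra_simps)
  qed (rule x)
  have g: "restrict_fun L h q = ereal (c + (q - p) \<bullet> x)" if "q \<in> S" for q
    using on_P S that by (auto simp: restrict_fun_def)
  have "S \<subseteq> eff_dom (restrict_fun L h)"
    by (auto simp: eff_dom_def g)
  then have "conv_fun (restrict_fun L h) p \<le> (\<Sum>q\<in>S. ereal (u q) * restrict_fun L h q)"
    unfolding conv_fun_def by (intro Inf_lower) (use S u comb in blast)
  also have "\<dots> = ereal (\<Sum>q\<in>S. u q * (c + (q - p) \<bullet> x))"
    by (simp add: g)
  also have "(\<Sum>q\<in>S. u q * (c + (q - p) \<bullet> x))
      = (\<Sum>q\<in>S. u q * (c - p \<bullet> x) + u q * (q \<bullet> x))"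
    by (simp add: algebra_simps)
  also have "\<dots> = sum u S * (c - p \<bullet> x) + (\<Sum>q\<in>S. u q *\<^sub>R q) \<bullet> x"
    by (simp add: sum.distrib inner_sum_left sum_distrib_right)
  also have "\<dots> = c"
    using u comb by simp
  finally show ?thesis
    by (simp add: real)
next
  case MInf
  then show ?thesis
    using proper by (simp add: proper_fun_def)
qed simp

section \<open>Recovering a primal-integral function from its lattice values\<close>

lemma primal_integral_M_convex_fun_eq_hulls:
  fixes h :: "'a::euclidean_space \<Rightarrow> ereal"
  assumes "primal_integral_M_convex_fun \<Phi> h"
  shows "conv_fun (restrict_fun (root_lattice \<Phi>) h) = h"
    and "closed_conv_fun (restrict_fun (root_lattice \<Phi>) h) = h"
proof -
  let ?g = "restrict_fun (root_lattice \<Phi>) h"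
  have h: "locally_polyhedral_convex_fun h" "proper_fun h"
    and hulls: "\<And>P. P \<in> argmin_sets h \<Longrightarrow> P = convex hull (P \<inter> root_lattice \<Phi>)"
    using assms unfolding primal_integral_M_convex_fun_def integral_M_convex_polyhedron_def
    by blast+
  have "h p \<le> closed_conv_fun ?g p" "closed_conv_fun ?g p \<le> conv_fun ?g p" "conv_fun ?g p \<le> h p"
    for p
    using le_closed_conv_fun_restrict[OF h] closed_conv_fun_le_conv_fun
      conv_fun_restrict_le[OF h hulls] by blast+
  then show "conv_fun ?g = h" "closed_conv_fun ?g = h"
    by (meson ext order_antisym order_trans)+
qed

theorem proposition6p6:
  fixes \<Phi> :: "'a::euclidean_space set" and g :: "'a \<Rightarrow> ereal"
  assumes "root_system \<Phi>"
    and "essential \<Phi>"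
    and "\<And>\<Psi>. irreducible_component \<Phi> \<Psi> \<Longrightarrow> classical_type \<Psi>"
    and "M_convex_lattice_fun \<Phi> g"
  shows "conv_fun g = closed_conv_fun g \<and>
         primal_integral_M_convex_fun \<Phi> (conv_fun g) \<and>
         restrict_fun (root_lattice \<Phi>) (conv_fun g) = g \<and>
         (\<forall>h. primal_integral_M_convex_fun \<Phi> h \<and> restrict_fun (root_lattice \<Phi>) h = g \<longrightarrow>
              h = conv_fun g)"
proof -
  obtain h where h: "primal_integral_M_convex_fun \<Phi> h" "g = restrict_fun (root_lattice \<Phi>) h"
    using assms(4) unfolding M_convex_lattice_fun_def by blast
  have "conv_fun g = h" "closed_conv_fun g = h"
    using primal_integral_M_convex_fun_eq_hulls[OF h(1)] h(2) by simp_all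
  moreover have "h' = conv_fun g"
    if "primal_integral_M_convex_fun \<Phi> h'" "restrict_fun (root_lattice \<Phi>) h' = g" for h'
    using primal_integral_M_convex_fun_eq_hulls(1)[OF that(1)] that(2) by simp
  ultimately show ?thesis
    using h by simp
qed

end
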